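(* Let $\bar w\sim\mathcal{N}(0,\bar\Sigma)$ with $\bar\Sigma>0$, let $\eta(\bar x_\theta,\bar u_\theta)=T^x\bar x_\theta+T^u\bar u_\theta-y$ with $T^x\in\mathbb{R}^{r\times(N+1)n}$, $T^u\in\mathbb{R}^{r\times Nm}$, $y\in\mathbb{R}^r$, and let $\alpha_i\in\,]0,1[$, $i=1,\dots,r$. For each $i$, the constraint $$\mathbb{P}(\eta_i(\bar x_\theta,\bar u_\theta)\le 0)\ge 1-\alpha_i$$ is equivalent to the second-order cone constraint in the parameters $\theta\in\Theta$ $$h_{i,\theta}+\beta_i\,\|\bar\Sigma^{1/2}P_{i,\theta}\|\le 0,$$ where $\beta_i=\sqrt{2}\,\mathrm{erf}^{-1}(1-2\alpha_i)$. As a consequence, if $V:\mathbb{R}^{(N+1)n}\times\mathbb{R}^{Nm}\to\mathbb{R}$ is measurable and convex, $\mathbb{E}[V(\bar x_\theta,\bar u_\theta)]$ is finite for all $\theta\in\Theta$, and $\alpha_1+\cdots+\alpha_r=\alpha$ with $\alpha\in\,]0,1[$, then the problem $$\inf_{\theta\in\Theta}\ \mathbb{E}[V(\bar x_\theta,\bar u_\theta)]\quad\text{subject to}\quad h_{i,\theta}+\beta_i\|\bar\Sigma^{1/2}P_{i,\theta}\|\le 0,\ i=1,\dots,r,$$ is a convex conservative approximation of the problem $$\inf_{\theta\in\Theta}\ \mathbb{E}[V(\bar x_\theta,\bar u_\theta)]\quad\text{subject to}\quad \mathbb{P}(\eta(\bar x_\theta,\bar u_\theta)\le 0)\ge 1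-\alpha.$$
   Context: Let $n,m,N,r\ge 1$ be integers, $A\in\mathbb{R}^{n\times n}$, $B\in\mathbb{R}^{n\times m}$, $x_0\in\mathbb{R}^n$, and let $w(0),\dots,w(N-1)$ be $\mathbb{R}^n$-valued random vectors on a probability space $(\Omega,\mathfrak{F},\mathbb{P})$, stacked into $\bar w\in\mathbb{R}^{Nn}$. The linear system $x(t+1)=Ax(t)+Bu(t)+w(t)$, $x(0)=x_0$, is written over $t=0,\dots,N$ as $\bar x=\bar A x_0+\bar B\bar u+\bar D\bar w$, where $\bar x\in\mathbb{R}^{(N+1)n}$ stacks $x(0),\dots,x(N)$ and $\bar u\in\mathbb{R}^{Nm}$ stacks $u(0),\dots,u(N-1)$; $\bar A$ stacks $I_n,A,\dots,A^N$; $\bar B$ is the $(N+1)n\times Nm$ matrix whose $n\times m$ block in position $(t,s)$, $0\le t\le N$, $0\le s\le N-1$, is $A^{t-1-s}B$ if $s<t$ and $0$ otherwise; $\bar D$ is the $(N+1)n\times Nn$ matrix whose $n\times n$ block $(t,s)$ is $A^{t-1-s}$ if $s<t$ and $0$ otherwise. $\Theta$ is the linear space of parameters $\theta=(\bar G,\bar d)$ with $\bar d\in\mathbb{R}^{Nm}$ and $\bar G\in\mathbb{R}^{Nm\times Nn}$ strictly block lower triangular (its $m\times n$ block $(t,i)$, $0\le t,i\le N-1$, vanishes whenever $i\ge t$). For $\theta\in\Theta$, $\bar u_\theta=\bar G\bar w+\bar d$ and $\bar x_\theta=\bar A x_0+\bar B(\bar G\bar w+\bar d)+\bar D\bar w$.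 Set $h_\theta=(T^x\bar A x_0-y)+(T^x\bar B+T^u)\bar d\in\mathbb{R}^r$ and $P_\theta=T^x\bar D+(T^x\bar B+T^u)\bar G\in\mathbb{R}^{r\times Nn}$, so that $\eta(\bar x_\theta,\bar u_\theta)=h_\theta+P_\theta\bar w$; $h_{i,\theta}$ is the $i$-th entry of $h_\theta$ and $P_{i,\theta}^T$ the $i$-th row of $P_\theta$. $\bar\Sigma^{1/2}$ is a symmetric real square root of $\bar\Sigma$, $\|\cdot\|$ is the Euclidean norm, vector inequalities are componentwise, and $\mathrm{erf}^{-1}$ is the inverse of $\mathrm{erf}(x)=\frac{2}{\sqrt\pi}\int_0^x e^{-u^2}du$. A problem is a convex conservative approximation of another problem with the same objective if its objective is convex, its feasible set is convex, and every $\theta$ feasible for it is feasible for the other problem.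
   Formalization: For α_i > 1/2 the constraint need not be a second-order cone constraint nor the feasible set convex; these two claims are stated only for α_i ≤ 1/2, while the equivalence, the conservative approximation and the convexity of the objective are stated for all α_i in ]0,1[. *)

theory Defs
  imports "HOL-Probability.Probability"
begin

text \<open>
  The horizon \<open>N\<close> is the cardinality of a finite linearly ordered type \<open>'N\<close>, whose elements in
  increasing order stand for the times \<open>0, \<dots>, N - 1\<close>. The times \<open>0, \<dots>, N\<close> of the stacked state
  are the elements of \<open>'N option\<close>: \<open>None\<close> is time \<open>0\<close> and \<open>Some t\<close> is the time following \<open>t\<close>.
  A stacked vector is indexed by pairs (time, component), so that the \<open>(t, s)\<close> block of a matrix
  consists of its entries at \<open>(t, _)\<close>, \<open>(s, _)\<close>.
\<close>

definition time :: "'N::{finite, linorder} \<Rightarrow> nat" where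
  "time t = card {s. s < t}"

definition state_time :: "'N::{finite, linorder} option \<Rightarrow> nat" where
  "state_time t = (case t of None \<Rightarrow> 0 | Some s \<Rightarrow> Suc (time s))"

(* The power operation of class monoid_mult is entrywise on real ^ 'n ^ 'n. *)
definition matpow :: "real ^ 'n ^ 'n \<Rightarrow> nat \<Rightarrow> real ^ 'n ^ 'n" where
  "matpow A k = (((**) A) ^^ k) (mat 1)"

definition Abar :: "real ^ 'n ^ 'n \<Rightarrow> real ^ 'n ^ ('N::{finite, linorder} option \<times> 'n)" where
  "Abar A = (\<chi> p q. matpow A (state_time (fst p)) $ snd p $ q)"

definition Bbar :: "real ^ 'n ^ 'n \<Rightarrow> real ^ 'm ^ 'n
    \<Rightarrow> real ^ ('N \<times> 'm) ^ ('N::{finite, linorder} option \<times> 'n)" where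
  "Bbar A B = (\<chi> p q. if time (fst q) < state_time (fst p)
     then (matpow A (state_time (fst p) - 1 - time (fst q)) ** B) $ snd p $ snd q else 0)"

definition Dbar :: "real ^ 'n ^ 'n
    \<Rightarrow> real ^ ('N \<times> 'n) ^ ('N::{finite, linorder} option \<times> 'n)" where
  "Dbar A = (\<chi> p q. if time (fst q) < state_time (fst p)
     then matpow A (state_time (fst p) - 1 - time (fst q)) $ snd p $ snd q else 0)"

type_synonym ('n, 'm, 'N) policy = "(real ^ ('N \<times> 'n) ^ ('N \<times> 'm)) \<times> (real ^ ('N \<times> 'm))"

definition Theta :: "('n::finite, 'm::finite, 'N::{finite, linorder}) policy set" where
  "Theta = {(G, d). \<forall>t i a b. t \<le> i \<longrightarrow> G $ (t, a) $ (i, b) = 0}"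

definition stack :: "('N::finite \<Rightarrow> 'w \<Rightarrow> real ^ 'n) \<Rightarrow> 'w \<Rightarrow> real ^ ('N \<times> 'n)" where
  "stack w \<omega> = (\<chi> p. w (fst p) \<omega> $ snd p)"

definition ubar :: "('n::finite, 'm::finite, 'N::{finite, linorder}) policy
    \<Rightarrow> real ^ ('N \<times> 'n) \<Rightarrow> real ^ ('N \<times> 'm)" where
  "ubar \<theta> wb = fst \<theta> *v wb + snd \<theta>"

definition xbar :: "real ^ 'n ^ 'n \<Rightarrow> real ^ 'm ^ 'n \<Rightarrow> real ^ 'n
    \<Rightarrow> ('n, 'm, 'N::{finite, linorder}) policy
    \<Rightarrow> real ^ ('N \<times> 'n) \<Rightarrow> real ^ ('N option \<times> 'n)" where
  "xbar A B x0 \<theta> wb = Abar A *v x0 + Bbar A B *v (fst \<theta> *v wb + snd \<theta>) + Dbar A *v wb"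

definition eta :: "real ^ ('N::finite option \<times> 'n::finite) ^ 'r \<Rightarrow> real ^ ('N \<times> 'm::finite) ^ 'r
    \<Rightarrow> real ^ 'r \<Rightarrow> real ^ ('N option \<times> 'n) \<Rightarrow> real ^ ('N \<times> 'm) \<Rightarrow> real ^ 'r" where
  "eta Tx Tu y x u = Tx *v x + Tu *v u - y"

definition h_vec :: "real ^ 'n ^ 'n \<Rightarrow> real ^ 'm ^ 'n \<Rightarrow> real ^ 'n
    \<Rightarrow> real ^ ('N::{finite, linorder} option \<times> 'n) ^ 'r \<Rightarrow> real ^ ('N \<times> 'm) ^ 'r \<Rightarrow> real ^ 'r
    \<Rightarrow> ('n, 'm, 'N) policy \<Rightarrow> real ^ 'r" where
  "h_vec A B x0 Tx Tu y \<theta> = ((Tx ** Abar A) *v x0 - y) + (Tx ** Bbar A B + Tu) *v snd \<theta>"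

definition P_mat :: "real ^ 'n ^ 'n \<Rightarrow> real ^ 'm ^ 'n
    \<Rightarrow> real ^ ('N::{finite, linorder} option \<times> 'n) ^ 'r \<Rightarrow> real ^ ('N \<times> 'm) ^ 'r
    \<Rightarrow> ('n, 'm, 'N) policy \<Rightarrow> real ^ ('N \<times> 'n) ^ 'r" where
  "P_mat A B Tx Tu \<theta> = Tx ** Dbar A + (Tx ** Bbar A B + Tu) ** fst \<theta>"

definition positive_definite :: "real ^ 'k ^ 'k \<Rightarrow> bool" where
  "positive_definite Q \<longleftrightarrow> transpose Q = Q \<and> (\<forall>x. x \<noteq> 0 \<longrightarrow> x \<bullet> (Q *v x) > 0)"

(* The law N(0, Q), given by its density; for positive definite Q only. *)
definition centered_gaussian :: "'w measure \<Rightarrow> ('w \<Rightarrow> real ^ 'k) \<Rightarrow> real ^ 'k ^ 'k \<Rightarrow> bool" where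
  "centered_gaussian M X Q \<longleftrightarrow>
     distributed M lborel X
       (\<lambda>x. ennreal (exp (- (x \<bullet> (matrix_inv Q *v x)) / 2) / sqrt ((2 * pi) ^ CARD('k) * det Q)))"

(* LBINT u=a..b is the oriented interval integral, so erf is odd. *)
definition erf :: "real \<Rightarrow> real" where
  "erf x = 2 / sqrt pi * (LBINT u=0..x. exp (- u\<^sup>2))"

definition beta :: "real \<Rightarrow> real" where
  "beta a = sqrt 2 * the_inv erf (1 - 2 * a)"

(* On S, the condition C is the cone constraint ||L x + b|| <= l x + c with L valued in 'b. *)
definition soc_constraint ::
    "'b::euclidean_space itself \<Rightarrow> 'a::real_vector set \<Rightarrow> ('a \<Rightarrow> bool) \<Rightarrow> bool" where
  "soc_constraint _ S C \<longleftrightarrow>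
     (\<exists>(L :: 'a \<Rightarrow> 'b) b (l :: 'a \<Rightarrow> real) c. linear L \<and> linear l \<and>
        (\<forall>x\<in>S. C x \<longleftrightarrow> norm (L x + b) \<le> l x + c))"

text \<open>The problem of minimizing an objective over the points of a domain subject to a constraint.\<close>

datatype 'a problem =
  Problem (domain: "'a set") (objective: "'a \<Rightarrow> real") (constraint: "'a \<Rightarrow> bool")

definition feasible :: "'a problem \<Rightarrow> 'a set" where
  "feasible p = {x \<in> domain p. constraint p x}"

definition conservative_approximation :: "'a problem \<Rightarrow> 'a problem \<Rightarrow> bool" where
  "conservative_approximation p q \<longleftrightarrow>
     domain p = domain q \<and> (\<forall>x\<in>domain p. objective p x = objective q x) \<and>
     feasible p \<subseteq> feasible q"

definition convex_conservative_approximation ::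
    "'a::real_vector problem \<Rightarrow> 'a problem \<Rightarrow> bool" where
  "convex_conservative_approximation p q \<longleftrightarrow>
     conservative_approximation p q \<and>
     convex_on (domain p) (objective p) \<and> convex (feasible p)"

end

theory Submission
  imports Defs
begin

text \<open>
  For a fixed policy \<open>\<theta>\<close> the vector \<open>\<eta>\<close> is an affine function \<open>h + P w\<close> of the stacked noise
  (\<open>eta_eq_affine\<close>), so its \<open>i\<close>-th entry is \<open>h\<^sub>i + p \<bullet> w\<close> with \<open>p\<close> the \<open>i\<close>-th row of \<open>P\<close>. Under
  \<open>N(0, S\<^sup>2)\<close> the scalar \<open>p \<bullet> w\<close> is normal with mean \<open>0\<close> and standard deviation \<open>\<parallel>S p\<parallel>\<close>
  (\<open>centered_gaussian_inner_le\<close>). Since \<open>beta a\<close> is the \<open>(1 - a)\<close>-quantile of the standard normal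
  law (\<open>std_normal_cdf_beta\<close>), the chance constraint says \<open>beta a \<le> - h\<^sub>i / \<parallel>S p\<parallel>\<close>, which is the
  cone constraint; the degenerate case \<open>S p = 0\<close> is deterministic (\<open>chance_constraint_iff\<close>).

  The law of \<open>p \<bullet> w\<close> comes from writing \<open>w = S R z\<close>, where the orthogonal map \<open>R\<close> sends the direction
  of a coordinate vector \<open>e\<close> to the direction of \<open>S p\<close>. Then \<open>p \<bullet> w = S p \<bullet> R z = \<parallel>S p\<parallel> (z \<bullet> e)\<close>, and
  the quadratic form in the density of \<open>w\<close> turns into \<open>z \<bullet> z\<close>, so that \<open>z\<close> has independent standard
  normal coordinates. The Jacobian of this substitution is some constant
  (\<open>nn_integral_lborel_linear\<close>), and the total mass \<open>1\<close> determines it together with the normalising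
  factor of the density.

  For the optimization problems, the union bound turns the \<open>r\<close> individual constraints into the joint
  one (\<open>union_bound_componentwise\<close>). The trajectory is affine in \<open>\<theta>\<close>, so the expected cost is convex.
  For \<open>\<alpha>\<^sub>i \<le> 1 / 2\<close> the factor \<open>beta (\<alpha>\<^sub>i)\<close> is nonnegative and can be moved inside the norm, which
  exhibits the constraint as a second-order cone constraint and makes its solution set convex.
\<close>

section \<open>The error function and the normal quantile\<close>

lemma erf_has_real_derivative:
  "(erf has_real_derivative (2 / sqrt pi * exp (- x\<^sup>2))) (at x)"
proof -
  define r where "r = \<bar>x\<bar> + 1"
  have "((\<lambda>u. LBINT y=ereal 0..ereal u. exp (- y\<^sup>2)) has_vector_derivative exp (- x\<^sup>2))
      (at x within {-r..r})"
    by (rule interval_integral_FTC2) (auto simp: r_def intro!: continuous_intros)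
  moreover have "at x within {-r..r} = at x"
    by (rule at_within_interior) (auto simp: r_def)
  ultimately have "((\<lambda>u. LBINT y=ereal 0..ereal u. exp (- y\<^sup>2)) has_real_derivative exp (- x\<^sup>2)) (at x)"
    by (simp add: has_real_derivative_iff_has_vector_derivative)
  from DERIV_cmult[OF this, of "2 / sqrt pi"] show ?thesis
    by (simp add: erf_def[abs_def] zero_ereal_def)
qed

lemma erf_strict_mono: "strict_mono erf"
proof (rule strict_monoI)
  fix x y :: real
  assume "x < y"
  then show "erf x < erf y"
    by (rule DERIV_pos_imp_increasing) (auto intro!: exI erf_has_real_derivative)
qed

lemma erf_minus: "erf (- x) = - erf x"
proof -
  have "(LBINT u=0..ereal (- x). exp (- u\<^sup>2)) = (LBINT u=ereal x..0. exp (- u\<^sup>2))"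
    by (subst interval_integral_reflect) simp
  also have "\<dots> = - (LBINT u=0..ereal x. exp (- u\<^sup>2))"
    by (rule interval_integral_endpoints_reverse)
  finally show ?thesis
    by (simp add: erf_def)
qed

text \<open>
  The function \<open>x \<mapsto> erf (x / sqrt 2) / 2\<close> is an antiderivative of the standard normal density.
\<close>

lemma std_normal_cdf_diff:
  assumes "a < b"
  shows "cdf std_normal_distribution b - cdf std_normal_distribution a
    = (erf (b / sqrt 2) - erf (a / sqrt 2)) / 2"
proof -
  interpret real_distribution std_normal_distribution
    by (rule real_dist_normal_dist)
  have "cdf std_normal_distribution b - cdf std_normal_distribution a
      = measure std_normal_distribution {a<..b}"
    using assms by (rule cdf_diff_eq)
  also have "\<dots> = (\<integral>x. indicator {a<..b} x \<partial>std_normal_distribution)"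
    by simp
  also have "\<dots> = (LBINT x:{a<..b}. std_normal_density x)"
    by (subst integral_density) (auto simp: set_lebesgue_integral_def mult.commute)
  also have "\<dots> = (LBINT x=ereal a..ereal b. std_normal_density x)"
    using assms by (simp add: interval_integral_Ioc)
  also have "\<dots> = erf (b / sqrt 2) / 2 - erf (a / sqrt 2) / 2"
  proof (rule interval_integral_FTC_finite)
    show "continuous_on {min a b..max a b} std_normal_density"
      unfolding std_normal_density_def by (intro continuous_intros) auto
    fix x :: real
    have "((\<lambda>x. erf (x / sqrt 2) / 2) has_real_derivative
        (2 / sqrt pi * exp (- (x / sqrt 2)\<^sup>2) * (1 / sqrt 2)) / 2) (at x)"
      by (intro DERIV_cdivide DERIV_chain2[OF erf_has_real_derivative]) (auto intro!: derivative_eq_intros)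
    also have "(2 / sqrt pi * exp (- (x / sqrt 2)\<^sup>2) * (1 / sqrt 2)) / 2 = std_normal_density x"
      by (simp add: std_normal_density_def power_divide real_sqrt_mult field_simps)
    finally show "((\<lambda>x. erf (x / sqrt 2) / 2) has_vector_derivative std_normal_density x)
        (at x within {min a b..max a b})"
      by (auto simp: has_real_derivative_iff_has_vector_derivative intro: has_vector_derivative_at_within)
  qed
  finally show ?thesis by (simp add: diff_divide_distrib)
qed

text \<open>
  Increments of the two sides agree, so only the value at \<open>0\<close> is at stake. Because \<open>erf\<close> is odd, the
  mass of \<open>]-b, b]\<close> is twice that of \<open>]0, b]\<close>; letting \<open>b\<close> tend to infinity yields
  \<open>1 = 2 (1 - F(0))\<close>.
\<close>

lemma std_normal_cdf_eq_erf:
  "cdf std_normal_distribution x = (1 + erf (x / sqrt 2)) / 2"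
proof -
  interpret real_distribution std_normal_distribution
    by (rule real_dist_normal_dist)
  let ?F = "cdf std_normal_distribution"
  have erf0: "erf 0 = 0"
    using erf_minus[of 0] by simp
  have "eventually (\<lambda>b. ?F b - ?F (- b) = 2 * (?F b - ?F 0)) at_top"
    using eventually_gt_at_top[of 0]
  proof eventually_elim
    fix b :: real
    assume "0 < b"
    then show "?F b - ?F (- b) = 2 * (?F b - ?F 0)"
      using std_normal_cdf_diff[of "- b" b] std_normal_cdf_diff[of 0 b] erf_minus[of "b / sqrt 2"]
      by (simp add: erf0)
  qed
  moreover have "((\<lambda>b. ?F b - ?F (- b)) \<longlongrightarrow> 1 - 0) at_top"
    by (intro tendsto_diff cdf_lim_at_top_prob filterlim_compose[OF cdf_lim_at_bot]
        filterlim_uminus_at_bot_at_top)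
  ultimately have "((\<lambda>b. 2 * (?F b - ?F 0)) \<longlongrightarrow> 1 - 0) at_top"
    by (rule Lim_transform_eventually[rotated])
  moreover have "((\<lambda>b. 2 * (?F b - ?F 0)) \<longlongrightarrow> 2 * (1 - ?F 0)) at_top"
    by (intro tendsto_intros cdf_lim_at_top_prob)
  ultimately have "1 - 0 = 2 * (1 - ?F 0)"
    by (intro tendsto_unique) auto
  then have F0: "?F 0 = 1 / 2" by simp
  consider "x < 0" | "x = 0" | "0 < x" by linarith
  then show ?thesis
  proof cases
    case 1
    with std_normal_cdf_diff[of x 0] F0 erf0 show ?thesis by simp
  next
    case 2
    with F0 erf0 show ?thesis by simp
  next
    case 3
    with std_normal_cdf_diff[of 0 x] F0 erf0 show ?thesis by simp
  qed
qed

lemma std_normal_cdf_strict_mono: "strict_mono (cdf std_normal_distribution)"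
proof (rule strict_monoI)
  fix x y :: real
  assume "x < y"
  then have "erf (x / sqrt 2) < erf (y / sqrt 2)"
    by (intro strict_monoD[OF erf_strict_mono] divide_strict_right_mono) auto
  then show "cdf std_normal_distribution x < cdf std_normal_distribution y"
    by (simp add: std_normal_cdf_eq_erf)
qed

text \<open>
  The intermediate value theorem provides a \<open>(1 - a)\<close>-quantile \<open>c\<close>, that is, \<open>erf (c / sqrt 2) = 1 - 2 a\<close>.
  This both shows that \<open>1 - 2 a\<close> lies in the range of \<open>erf\<close>, where \<open>the_inv\<close> is meaningful, and
  identifies \<open>c\<close> with \<open>beta a\<close>.
\<close>

lemma std_normal_cdf_beta:
  assumes "0 < a" "a < 1"
  shows "cdf std_normal_distribution (beta a) = 1 - a"
proof -
  interpret real_distribution std_normal_distribution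
    by (rule real_dist_normal_dist)
  let ?F = "cdf std_normal_distribution"
  obtain l where l: "?F l < 1 - a"
    using order_tendstoD(2)[OF cdf_lim_at_bot, of "1 - a"] assms(2)
    unfolding eventually_at_bot_linorder by (metis order_refl diff_gt_0_iff_gt)
  obtain u where u: "1 - a < ?F u"
    using order_tendstoD(1)[OF cdf_lim_at_top_prob, of "1 - a"] assms(1)
    unfolding eventually_at_top_linorder by (metis order_refl diff_less_eq less_add_same_cancel1)
  have "l \<le> u"
    using l u cdf_nondecreasing[of u l] by linarith
  moreover have "continuous_on {l..u} ?F"
  proof -
    have "continuous_on UNIV erf"
      by (intro continuous_at_imp_continuous_on ballI DERIV_isCont[OF erf_has_real_derivative])
    then have "continuous_on {l..u} (\<lambda>x. erf (x / sqrt 2))"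
      by (rule continuous_on_compose2) (auto intro!: continuous_intros)
    then have "continuous_on {l..u} (\<lambda>x. (1 + erf (x / sqrt 2)) / 2)"
      by (intro continuous_intros) auto
    then show ?thesis
      by (rule continuous_on_eq) (simp add: std_normal_cdf_eq_erf)
  qed
  ultimately obtain c where c: "?F c = 1 - a"
    using IVT'[of ?F l "1 - a" u] l u by (metis less_imp_le)
  then have "erf (c / sqrt 2) = 1 - 2 * a"
    by (simp add: std_normal_cdf_eq_erf field_simps)
  then have "the_inv erf (1 - 2 * a) = c / sqrt 2"
    using the_inv_f_f[OF strict_mono_imp_inj_on[OF erf_strict_mono], of "c / sqrt 2"] by metis
  then have "beta a = c"
    by (simp add: beta_def)
  with c show ?thesis by simp
qed

lemma std_normal_cdf_ge_iff:
  assumes "0 < a" "a < 1"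
  shows "1 - a \<le> cdf std_normal_distribution c \<longleftrightarrow> beta a \<le> c"
  unfolding std_normal_cdf_beta[OF assms, symmetric]
  by (rule strict_mono_less_eq[OF std_normal_cdf_strict_mono])

lemma beta_nonneg:
  assumes "0 < a" "a \<le> 1 / 2"
  shows "0 \<le> beta a"
proof -
  have "cdf std_normal_distribution 0 \<le> cdf std_normal_distribution (beta a)"
    using assms erf_minus[of 0] std_normal_cdf_beta[of a] by (simp add: std_normal_cdf_eq_erf)
  then show ?thesis
    by (simp add: strict_mono_less_eq[OF std_normal_cdf_strict_mono])
qed

section \<open>Linear substitution in Lebesgue integrals\<close>

lemma nn_integral_lborel_translate:
  fixes f :: "'a::euclidean_space \<Rightarrow> ennreal"
  assumes "f \<in> borel_measurable borel"
  shows "(\<integral>\<^sup>+x. f (x + a) \<partial>lborel) = (\<integral>\<^sup>+x. f x \<partial>lborel)"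
proof -
  have "(\<integral>\<^sup>+x. f x \<partial>lborel) = (\<integral>\<^sup>+x. f x \<partial>(distr lborel borel ((+) a)))"
    by (simp add: lborel_distr_plus)
  also have "\<dots> = (\<integral>\<^sup>+x. f (x + a) \<partial>lborel)"
    using assms by (subst nn_integral_distr) (auto simp: add.commute)
  finally show ?thesis by simp
qed

text \<open>
  The constant is the inverse of the absolute determinant, but its existence only depends on
  translation invariance. With \<open>g\<close> the indicator of the unit ball, compute the integral of
  \<open>g(y) f(U x + y)\<close> over \<open>x\<close> and \<open>y\<close> in both orders. Surjectivity of \<open>U\<close> allows \<open>y\<close> to be absorbed
  by a shift of \<open>x\<close>, giving \<open>(\<integral>g) (\<integral>f \<circ> U)\<close>; absorbing \<open>U x\<close> by a shift of \<open>y\<close>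
  instead, and then \<open>y\<close> by a shift of \<open>x\<close>, gives \<open>(\<integral>g(- U x)) (\<integral>f)\<close>.
\<close>

lemma nn_integral_lborel_linear:
  fixes U :: "'a::euclidean_space \<Rightarrow> 'a"
  assumes U: "linear U" and surj: "surj U"
  obtains c where "\<And>f. f \<in> borel_measurable borel \<Longrightarrow>
    (\<integral>\<^sup>+x. f (U x) \<partial>lborel) = c * (\<integral>\<^sup>+x. f x \<partial>lborel)"
proof -
  let ?g = "indicator (ball 0 1) :: 'a \<Rightarrow> ennreal"
  define k where "k = emeasure lborel (ball (0::'a) 1)"
  define c where "c = (\<integral>\<^sup>+x. ?g (- U x) \<partial>lborel) / k"
  have k0: "k \<noteq> 0"
    unfolding k_def by (simp add: emeasure_ball unit_ball_vol_pos less_imp_neq[THEN not_sym])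
  have k1: "k \<noteq> \<top>"
    using emeasure_lborel_ball_finite[of "0::'a" 1] by (simp add: k_def less_top)
  have cU: "continuous_on A U" for A
    using U by (rule linear_continuous_on[OF linear_conv_bounded_linear[THEN iffD1]])
  have [measurable]: "U \<in> borel_measurable borel"
    using cU by (rule borel_measurable_continuous_onI)
  have [measurable]: "ball (0::'a) 1 \<in> sets borel"
    by simp
  from surj obtain T where UT: "\<And>y. U (T y) = y"
    by (metis surjD)
  have shift: "U (x + T y) = U x + y" for x y
    by (simp add: linear_add[OF U] UT)
  have "(\<integral>\<^sup>+x. f (U x) \<partial>lborel) = c * (\<integral>\<^sup>+x. f x \<partial>lborel)"
    if [measurable]: "f \<in> borel_measurable borel" for f
  proof -
    have "k * (\<integral>\<^sup>+x. f (U x) \<partial>lborel) = (\<integral>\<^sup>+y. ?g y * (\<integral>\<^sup>+x. f (U x) \<partial>lborel) \<partial>lborel)"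
      by (subst nn_integral_multc) (auto simp: k_def intro!: borel_measurable_indicator)
    also have "\<dots> = (\<integral>\<^sup>+y. (\<integral>\<^sup>+x. ?g y * f (U x + y) \<partial>lborel) \<partial>lborel)"
    proof (rule nn_integral_cong)
      fix y
      have "(\<integral>\<^sup>+x. f (U x) \<partial>lborel) = (\<integral>\<^sup>+x. f (U (x + T y)) \<partial>lborel)"
        by (rule nn_integral_lborel_translate[symmetric]) simp
      then show "?g y * (\<integral>\<^sup>+x. f (U x) \<partial>lborel) = (\<integral>\<^sup>+x. ?g y * f (U x + y) \<partial>lborel)"
        by (simp add: nn_integral_cmult shift)
    qed
    also have "\<dots> = (\<integral>\<^sup>+x. (\<integral>\<^sup>+y. ?g y * f (U x + y) \<partial>lborel) \<partial>lborel)"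
      by (rule lborel_pair.Fubini') measurable
    also have "\<dots> = (\<integral>\<^sup>+x. (\<integral>\<^sup>+y. ?g (y - U x) * f y \<partial>lborel) \<partial>lborel)"
    proof (rule nn_integral_cong)
      fix x
      have "(\<integral>\<^sup>+y. ?g (y - U x) * f y \<partial>lborel)
          = (\<integral>\<^sup>+y. ?g (y + U x - U x) * f (y + U x) \<partial>lborel)"
        by (rule nn_integral_lborel_translate[symmetric]) simp
      then show "(\<integral>\<^sup>+y. ?g y * f (U x + y) \<partial>lborel)
          = (\<integral>\<^sup>+y. ?g (y - U x) * f y \<partial>lborel)"
        by (simp add: add.commute)
    qed
    also have "\<dots> = (\<integral>\<^sup>+y. (\<integral>\<^sup>+x. ?g (y - U x) * f y \<partial>lborel) \<partial>lborel)"
      by (rule lborel_pair.Fubini') measurable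
    also have "\<dots> = (\<integral>\<^sup>+y. (\<integral>\<^sup>+x. ?g (- U x) \<partial>lborel) * f y \<partial>lborel)"
    proof (rule nn_integral_cong)
      fix y
      have "(\<integral>\<^sup>+x. ?g (y - U x) \<partial>lborel) = (\<integral>\<^sup>+x. ?g (y - U (x + T y)) \<partial>lborel)"
        by (rule nn_integral_lborel_translate[symmetric]) simp
      then show "(\<integral>\<^sup>+x. ?g (y - U x) * f y \<partial>lborel) = (\<integral>\<^sup>+x. ?g (- U x) \<partial>lborel) * f y"
        by (simp add: nn_integral_multc shift)
    qed
    also have "\<dots> = (\<integral>\<^sup>+x. ?g (- U x) \<partial>lborel) * (\<integral>\<^sup>+y. f y \<partial>lborel)"
      by (rule nn_integral_cmult) simp
    also have "\<dots> = k * (c * (\<integral>\<^sup>+y. f y \<partial>lborel))"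
      using k0 k1 by (simp add: c_def ennreal_times_divide mult.assoc[symmetric] 
          ennreal_mult_divide_eq mult.commute[of k])
    finally show ?thesis
      using k0 k1 by (simp add: ennreal_mult_cancel_left)
  qed
  then show ?thesis by (rule that)
qed

section \<open>Linear functionals of a Gaussian vector\<close>

lemma exp_neg_half_inner_self:
  fixes z :: "'a::euclidean_space"
  shows "exp (- (z \<bullet> z) / 2) = sqrt (2 * pi) ^ DIM('a) * (\<Prod>b\<in>Basis. std_normal_density (z \<bullet> b))"
proof -
  have "(\<Prod>b\<in>Basis. std_normal_density (z \<bullet> b))
      = (\<Prod>b\<in>(Basis::'a set). 1 / sqrt (2 * pi)) * (\<Prod>b\<in>Basis. exp (- (z \<bullet> b)\<^sup>2 / 2))"
    by (simp only: std_normal_density_def prod.distrib)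
  also have "(\<Prod>b\<in>Basis. exp (- (z \<bullet> b)\<^sup>2 / 2)) = exp (\<Sum>b\<in>Basis. - (z \<bullet> b)\<^sup>2 / 2)"
    by (simp add: exp_sum)
  also have "(\<Sum>b\<in>Basis. - (z \<bullet> b)\<^sup>2 / 2) = - (z \<bullet> z) / 2"
    by (simp add: euclidean_inner[of z z] sum_negf sum_divide_distrib power2_eq_square)
  finally show ?thesis
    by (simp add: power_divide)
qed

text \<open>
  Each coordinate of a vector with density \<open>\<Prod>b. std_normal_density (z \<bullet> b)\<close> is standard normal: the
  integrand is a product of functions of single coordinates, and all factors but the one at \<open>e\<close>
  integrate to \<open>1\<close>.
\<close>

lemma nn_integral_std_normal_coordinate:
  fixes e :: "'a::euclidean_space"
  assumes e: "e \<in> Basis" and [measurable]: "A \<in> sets borel"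
  shows "(\<integral>\<^sup>+z. ennreal (\<Prod>b\<in>Basis. std_normal_density (z \<bullet> b)) * indicator {z. z \<bullet> e \<in> A} z \<partial>lborel)
    = emeasure std_normal_distribution A"
proof -
  let ?f = "\<lambda>b x. ennreal (std_normal_density x) * (if b = e then indicator A x else 1)"
  have total: "(\<integral>\<^sup>+x. ennreal (std_normal_density x) \<partial>lborel) = 1"
    using prob_space.emeasure_space_1[OF prob_space_normal_density[of 1 0]]
    by (simp add: emeasure_density)
  have "ennreal (\<Prod>b\<in>Basis. std_normal_density (z \<bullet> b)) * indicator {z. z \<bullet> e \<in> A} z
      = (\<Prod>b\<in>Basis. ?f b (z \<bullet> b))" for z
    using e by (simp add: prod.distrib prod_ennreal indicator_def prod.delta)
  then have "(\<integral>\<^sup>+z. ennreal (\<Prod>b\<in>Basis. std_normal_density (z \<bullet> b)) * indicator {z. z \<bullet> e \<in> A} z \<partial>lborel)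
      = (\<integral>\<^sup>+z. (\<Prod>b\<in>Basis. ?f b (z \<bullet> b)) \<partial>lborel)"
    by simp
  also have "\<dots> = (\<Prod>b\<in>Basis. \<integral>\<^sup>+x. ?f b x \<partial>lborel)"
    by (rule nn_integral_lborel_prod) auto
  also have "\<dots> = (\<Prod>b\<in>Basis. if b = e then emeasure std_normal_distribution A else 1)"
    by (rule prod.cong) (auto simp: total emeasure_density)
  also have "\<dots> = emeasure std_normal_distribution A"
    using e by (simp add: prod.delta)
  finally show ?thesis .
qed

lemma symmetric_matrix_inner_move:
  fixes S :: "real ^ 'k ^ 'k"
  assumes "transpose S = S"
  shows "x \<bullet> (S *v y) = (S *v x) \<bullet> y"
  by (metis assms dot_lmul_matrix transpose_matrix_vector)

text \<open>
  In the coordinates \<open>x = S y\<close> the exponent of the Gaussian density is isotropic, as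
  \<open>S (S S)\<^sup>-\<^sup>1 S\<close> is the identity.
\<close>

lemma matrix_inv_square_quadratic_form:
  fixes S :: "real ^ 'k ^ 'k"
  assumes "transpose S = S" "surj ((*v) S)"
  shows "(S *v y) \<bullet> (matrix_inv (S ** S) *v (S *v y)) = y \<bullet> y"
proof -
  from assms(2) obtain S' where "S ** S' = mat 1"
    using matrix_right_invertible_surjective by blast
  then have inv: "invertible S"
    using matrix_left_right_inverse invertible_def by blast
  then have "invertible (S ** S)"
    by (simp add: invertible_mult)
  then have left: "matrix_inv (S ** S) ** (S ** S) = mat 1"
    unfolding matrix_inv_def invertible_def by (rule someI2_ex) blast
  from assms(2) obtain v where v: "y = S *v v"
    by (metis surjD)
  have "matrix_inv (S ** S) *v (S *v y) = v"
    unfolding v by (metis left matrix_vector_mul_assoc matrix_vector_mul_lid)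
  then show ?thesis
    using symmetric_matrix_inner_move[OF assms(1), of y v] v by simp
qed

lemma square_root_surj:
  fixes S :: "real ^ 'k ^ 'k"
  assumes "positive_definite (S ** S)"
  shows "surj ((*v) S)"
proof -
  have "x = 0" if "S *v x = 0" for x
  proof -
    have "x \<bullet> ((S ** S) *v x) = 0"
      using that by (simp flip: matrix_vector_mul_assoc)
    with assms show "x = 0"
      unfolding positive_definite_def by (metis less_irrefl)
  qed
  then have "inj ((*v) S)"
    using linear_injective_0[OF matrix_vector_mul_linear, of S] by blast
  then show ?thesis
    using linear_injective_imp_surjective[OF matrix_vector_mul_linear, of S] by blast
qed

text \<open>
  The substitution \<open>x = S R z\<close>, with \<open>R\<close> orthogonal and \<open>R (\<parallel>S p\<parallel> e) = S p\<close>, reduces the statement to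
  one coordinate of a vector of independent standard normal entries.
\<close>

lemma centered_gaussian_inner_le:
  fixes X :: "'w \<Rightarrow> real ^ 'k" and S :: "real ^ 'k ^ 'k"
  assumes "prob_space M" and gauss: "centered_gaussian M X (S ** S)"
    and pd: "positive_definite (S ** S)" and sym: "transpose S = S" and nz: "S *v p \<noteq> 0"
  shows "\<P>(\<omega> in M. p \<bullet> X \<omega> \<le> c) = cdf std_normal_distribution (c / norm (S *v p))"
proof -
  interpret prob_space M by fact
  let ?Q = "S ** S"
  define f where "f = (\<lambda>x. ennreal (exp (- (x \<bullet> (matrix_inv ?Q *v x)) / 2)
      / sqrt ((2 * pi) ^ CARD('k) * det ?Q)))"
  define s where "s = norm (S *v p)"
  have s: "0 < s" using nz by (simp add: s_def)
  have dist: "distributed M lborel X f"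
    using gauss by (simp add: centered_gaussian_def f_def)
  have X[measurable]: "X \<in> borel_measurable M"
    using distributed_measurable[OF dist] by simp
  have f[measurable]: "f \<in> borel_measurable borel"
    using distributed_borel_measurable[OF dist] by simp
  define e :: "real ^ 'k" where "e = axis undefined 1"
  have e: "e \<in> Basis"
    by (auto simp: e_def)
  obtain R where R: "orthogonal_transformation R" and Re: "R (s *\<^sub>R e) = S *v p"
    by (rule orthogonal_transformation_exists[of "s *\<^sub>R e" "S *v p"])
       (use e in \<open>auto simp: s_def\<close>)
  have Rlin: "linear R"
    using R by (rule orthogonal_transformation_linear)
  have Rsurj: "surj R"
    using R by (rule orthogonal_transformation_surj)
  define T where "T z = S *v R z" for z
  have T: "linear T" "surj T"
    unfolding T_def
     apply (rule linear_compose[OF Rlin matrix_vector_mul_linear, unfolded o_def])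
    using comp_surj[OF Rsurj square_root_surj[OF pd]] by (simp add: o_def)
  obtain U where U: "linear U" "\<And>x. T (U x) = x" "\<And>x. U (T x) = x"
  proof -
    have "inj T" using T linear_surjective_imp_injective by blast
    then have "bij T" using T(2) by (rule bijI)
    show ?thesis
      by (rule that[of "inv T"])
         (use T \<open>bij T\<close> in \<open>auto simp: bij_is_inj bij_is_surj surj_f_inv_f intro!: inj_linear_imp_inv_linear\<close>)
  qed
  have "surj U"
    using U(3) by (metis surjI)
  have [measurable]: "T \<in> borel_measurable borel"
    using T(1) by (intro borel_measurable_continuous_onI linear_continuous_on)
       (simp add: linear_conv_bounded_linear)
  \<comment> \<open>Since \<open>F x = (F \<circ> T) (U x)\<close>, this constant converts integrals over \<open>x = T z\<close> into integrals over \<open>z\<close>.\<close>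
  obtain k where k: "\<And>F. F \<in> borel_measurable borel \<Longrightarrow>
      (\<integral>\<^sup>+x. F (U x) \<partial>lborel) = k * (\<integral>\<^sup>+z. F z \<partial>lborel)"
    using nn_integral_lborel_linear[OF U(1) \<open>surj U\<close>] by blast
  define D where "D = ennreal (sqrt (2 * pi) ^ CARD('k) / sqrt ((2 * pi) ^ CARD('k) * det ?Q))"
  \<comment> \<open>\<open>K\<close> collects the Jacobian and all normalising factors; it is \<open>1\<close> by comparison of total masses.\<close>
  define K where "K = k * D"
  have fT: "f (T z) = D
      * ennreal (\<Prod>b\<in>Basis. std_normal_density (z \<bullet> b))" for z
  proof -
    have "T z \<bullet> (matrix_inv ?Q *v T z) = R z \<bullet> R z"
      unfolding T_def by (rule matrix_inv_square_quadratic_form[OF sym square_root_surj[OF pd]])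
    also have "\<dots> = z \<bullet> z"
      using R by (simp add: orthogonal_transformation_def)
    finally have "f (T z) = ennreal (sqrt (2 * pi) ^ CARD('k) * (\<Prod>b\<in>Basis. std_normal_density (z \<bullet> b))
        / sqrt ((2 * pi) ^ CARD('k) * det ?Q))"
      using exp_neg_half_inner_self[of z] by (simp only: f_def DIM_cart DIM_real mult_1_right)
    then show ?thesis
      unfolding D_def by (subst ennreal_mult''[symmetric]) (auto intro!: prod_nonneg)
  qed
  \<comment> \<open>In the new coordinates the functional is a multiple of the coordinate along \<open>e\<close>.\<close>
  have pT: "p \<bullet> T z = s * (z \<bullet> e)" for z
  proof -
    have "p \<bullet> T z = R (s *\<^sub>R e) \<bullet> R z"
      by (simp add: T_def Re symmetric_matrix_inner_move[OF sym])
    also have "\<dots> = (s *\<^sub>R e) \<bullet> z"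
      using R by (simp only: orthogonal_transformation_def)
    finally show ?thesis
      by (simp add: inner_commute)
  qed
  have law: "emeasure M {\<omega> \<in> space M. p \<bullet> X \<omega> \<in> A}
      = K * emeasure std_normal_distribution {t. s * t \<in> A}"
    if [measurable]: "A \<in> sets borel" for A
  proof -
    have "emeasure M {\<omega> \<in> space M. p \<bullet> X \<omega> \<in> A} = emeasure M (X -` {x. p \<bullet> x \<in> A} \<inter> space M)"
      by (auto intro: arg_cong[where f="emeasure M"])
    also have "\<dots> = (\<integral>\<^sup>+x. f x * indicator {x. p \<bullet> x \<in> A} x \<partial>lborel)"
      by (rule distributed_emeasure[OF dist]) simp
    also have "\<dots> = (\<integral>\<^sup>+x. (\<lambda>z. f (T z) * indicator {x. p \<bullet> x \<in> A} (T z)) (U x) \<partial>lborel)"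
      by (simp add: U)
    also have "\<dots> = k * (\<integral>\<^sup>+z. f (T z) * indicator {x. p \<bullet> x \<in> A} (T z) \<partial>lborel)"
      by (rule k) simp
    also have "(\<integral>\<^sup>+z. f (T z) * indicator {x. p \<bullet> x \<in> A} (T z) \<partial>lborel)
        = (\<integral>\<^sup>+z. D *
            (ennreal (\<Prod>b\<in>Basis. std_normal_density (z \<bullet> b))
              * indicator {z. z \<bullet> e \<in> {t. s * t \<in> A}} z) \<partial>lborel)"
      by (rule nn_integral_cong) (simp add: fT pT indicator_def mult.assoc)
    also have "\<dots> = D
        * emeasure std_normal_distribution {t. s * t \<in> A}"
      using nn_integral_std_normal_coordinate[OF e, of "{t. s * t \<in> A}"]
      by (subst nn_integral_cmult) simp_all
    finally show ?thesis
      by (simp add: K_def mult.assoc)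
  qed
  interpret N: real_distribution std_normal_distribution
    by (rule real_dist_normal_dist)
  have "K = 1"
    using law[of UNIV] N.emeasure_space_1 emeasure_space_1 by simp
  have "{t. s * t \<in> {..c}} = {..c / s}"
    using s by (auto simp: field_simps)
  then have "emeasure M {\<omega> \<in> space M. p \<bullet> X \<omega> \<le> c} = emeasure std_normal_distribution {..c / s}"
    using law[of "{..c}"] \<open>K = 1\<close> by simp
  then show ?thesis
    by (simp add: measure_def cdf_def s_def)
qed

section \<open>Chance constraints as cone constraints\<close>

text \<open>
  When \<open>S p = 0\<close> also \<open>p = 0\<close>, so the event is certain or impossible according to the sign of \<open>h\<close>;
  the bounds \<open>0 < a < 1\<close> make both sides equivalent to \<open>h \<le> 0\<close>.
\<close>

lemma chance_constraint_iff:
  fixes X :: "'w \<Rightarrow> real ^ 'k" and S :: "real ^ 'k ^ 'k"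
  assumes M: "prob_space M" and gauss: "centered_gaussian M X (S ** S)"
    and pd: "positive_definite (S ** S)" and sym: "transpose S = S" and a: "0 < a" "a < 1"
  shows "1 - a \<le> \<P>(\<omega> in M. h + p \<bullet> X \<omega> \<le> 0) \<longleftrightarrow> h + beta a * norm (S *v p) \<le> 0"
proof (cases "S *v p = 0")
  case False
  have "\<P>(\<omega> in M. h + p \<bullet> X \<omega> \<le> 0) = \<P>(\<omega> in M. p \<bullet> X \<omega> \<le> - h)"
    by (rule arg_cong[where f="measure M"]) auto
  also have "\<dots> = cdf std_normal_distribution (- h / norm (S *v p))"
    by (rule centered_gaussian_inner_le[OF M gauss pd sym False])
  finally have "1 - a \<le> \<P>(\<omega> in M. h + p \<bullet> X \<omega> \<le> 0) \<longleftrightarrow> beta a \<le> - h / norm (S *v p)"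
    using std_normal_cdf_ge_iff[OF a] by simp
  also have "\<dots> \<longleftrightarrow> h + beta a * norm (S *v p) \<le> 0"
    using False by (subst pos_le_divide_eq) auto
  finally show ?thesis .
next
  case True
  interpret prob_space M by fact
  have "inj ((*v) S)"
    using square_root_surj[OF pd] linear_surjective_imp_injective[OF matrix_vector_mul_linear, of S]
    by blast
  then have "p = 0"
    using True linear_injective_0[OF matrix_vector_mul_linear, of S] by blast
  then show ?thesis
    using True a prob_space by (cases "h \<le> 0") auto
qed

lemma (in prob_space) union_bound_componentwise:
  fixes Y :: "'a \<Rightarrow> real ^ 'r"
  assumes [measurable]: "Y \<in> borel_measurable M"
    and comp: "\<And>i. 1 - \<alpha> i \<le> \<P>(\<omega> in M. Y \<omega> $ i \<le> 0)"
  shows "1 - (\<Sum>i\<in>UNIV. \<alpha> i) \<le> \<P>(\<omega> in M. Y \<omega> \<le> 0)"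
proof -
  have [measurable]: "(\<lambda>\<omega>. Y \<omega> $ i) \<in> borel_measurable M" for i
  proof -
    have "(\<lambda>\<omega>. Y \<omega> \<bullet> axis i 1) \<in> borel_measurable M"
      by measurable
    then show ?thesis
      by (simp add: inner_axis)
  qed
  have eq: "{\<omega> \<in> space M. Y \<omega> \<le> 0} = space M - (\<Union>i. {\<omega> \<in> space M. \<not> Y \<omega> $ i \<le> 0})"
    by (auto simp: less_eq_vec_def)
  have "prob (\<Union>i. {\<omega> \<in> space M. \<not> Y \<omega> $ i \<le> 0})
      \<le> (\<Sum>i\<in>UNIV. prob {\<omega> \<in> space M. \<not> Y \<omega> $ i \<le> 0})"
    by (rule finite_measure_subadditive_finite) auto
  also have "\<dots> \<le> (\<Sum>i\<in>UNIV. \<alpha> i)"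
  proof (rule sum_mono)
    fix i
    show "prob {\<omega> \<in> space M. \<not> Y \<omega> $ i \<le> 0} \<le> \<alpha> i"
      using comp[of i] by (subst prob_neg) auto
  qed
  finally show ?thesis
    unfolding eq by (subst prob_compl) auto
qed

lemma convex_soc_constraint:
  assumes "soc_constraint TYPE('b::euclidean_space) S C" and S: "convex S"
  shows "convex {x \<in> S. C x}"
proof -
  from assms(1) obtain L :: "_ \<Rightarrow> 'b" and b l c where L: "linear L" and l: "linear l"
    and C: "\<And>x. x \<in> S \<Longrightarrow> C x \<longleftrightarrow> norm (L x + b) \<le> l x + c"
    unfolding soc_constraint_def by blast
  show ?thesis
  proof (rule convexI)
    fix x y u v
    assume xy: "x \<in> {x \<in> S. C x}" "y \<in> {x \<in> S. C x}" and uv: "0 \<le> u" "0 \<le> v" "u + v = (1::real)"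
    from S xy uv have in_S: "u *\<^sub>R x + v *\<^sub>R y \<in> S"
      by (auto intro: convexD)
    have b: "b = u *\<^sub>R b + v *\<^sub>R b" and c: "c = u * c + v * c"
      using uv by (simp_all flip: scaleR_left_distrib distrib_right)
    have "L (u *\<^sub>R x + v *\<^sub>R y) + b = u *\<^sub>R (L x + b) + v *\<^sub>R (L y + b)"
      by (subst b) (simp add: linear_add[OF L] linear_scale[OF L] algebra_simps)
    then have "norm (L (u *\<^sub>R x + v *\<^sub>R y) + b) \<le> u * norm (L x + b) + v * norm (L y + b)"
      using uv norm_triangle_ineq[of "u *\<^sub>R (L x + b)" "v *\<^sub>R (L y + b)"] by simp
    also have "\<dots> \<le> u * (l x + c) + v * (l y + c)"
      using xy uv C by (intro add_mono mult_left_mono) auto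
    also have "\<dots> = l (u *\<^sub>R x + v *\<^sub>R y) + c"
      by (subst (3) c) (simp add: linear_add[OF l] linear_scale[OF l] algebra_simps)
    finally show "u *\<^sub>R x + v *\<^sub>R y \<in> {x \<in> S. C x}"
      using in_S C by simp
  qed
qed

lemma convex_Theta: "convex Theta"
  by (rule convexI) (auto simp: Theta_def)

lemma eta_eq_affine:
  "eta Tx Tu y (xbar A B x0 \<theta> wb) (ubar \<theta> wb) = h_vec A B x0 Tx Tu y \<theta> + P_mat A B Tx Tu \<theta> *v wb"
  by (simp add: eta_def xbar_def ubar_def h_vec_def P_mat_def matrix_vector_mult_add_rdistrib
      matrix_vector_right_distrib matrix_vector_mul_assoc[symmetric] algebra_simps)

lemma eta_component_affine:
  "eta Tx Tu y (xbar A B x0 \<theta> wb) (ubar \<theta> wb) $ i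
    = h_vec A B x0 Tx Tu y \<theta> $ i + (P_mat A B Tx Tu \<theta> $ i) \<bullet> wb"
  by (simp add: eta_eq_affine matrix_vector_mul_component)

lemma trajectory_convex_combination:
  assumes "u + v = 1"
  shows "(xbar A B x0 (u *\<^sub>R \<theta> + v *\<^sub>R \<theta>') wb, ubar (u *\<^sub>R \<theta> + v *\<^sub>R \<theta>') wb)
    = u *\<^sub>R (xbar A B x0 \<theta> wb, ubar \<theta> wb) + v *\<^sub>R (xbar A B x0 \<theta>' wb, ubar \<theta>' wb)"
proof -
  have ub: "ubar (u *\<^sub>R \<theta> + v *\<^sub>R \<theta>') wb = u *\<^sub>R ubar \<theta> wb + v *\<^sub>R ubar \<theta>' wb"
    by (simp add: ubar_def matrix_vector_mult_add_rdistrib scaleR_matrix_vector_assoc[symmetric]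
        scaleR_right_distrib)
  let ?z = "Abar A *v x0 + Dbar A *v wb"
  have x: "xbar A B x0 \<theta> wb = ?z + Bbar A B *v ubar \<theta> wb" for \<theta>
    by (simp add: xbar_def ubar_def)
  have z: "?z = u *\<^sub>R ?z + v *\<^sub>R ?z"
    using assms by (simp flip: scaleR_left_distrib)
  have "xbar A B x0 (u *\<^sub>R \<theta> + v *\<^sub>R \<theta>') wb = u *\<^sub>R xbar A B x0 \<theta> wb + v *\<^sub>R xbar A B x0 \<theta>' wb"
    unfolding x ub
    by (subst z) (simp add: matrix_vector_right_distrib matrix_vector_mult_scaleR scaleR_right_distrib)
  with ub show ?thesis by simp
qed

lemma convex_on_expected_cost:
  fixes A :: "real ^ 'n ^ 'n" and B :: "real ^ 'm ^ 'n"
    and W :: "'w \<Rightarrow> real ^ ('N::{finite, linorder} \<times> 'n)"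
  assumes V: "convex_on UNIV V"
    and int: "\<And>\<theta>. \<theta> \<in> Theta \<Longrightarrow> integrable M (\<lambda>\<omega>. V (xbar A B x0 \<theta> (W \<omega>), ubar \<theta> (W \<omega>)))"
  shows "convex_on Theta (\<lambda>\<theta>. \<integral>\<omega>. V (xbar A B x0 \<theta> (W \<omega>), ubar \<theta> (W \<omega>)) \<partial>M)"
  unfolding convex_on_def
proof (intro conjI convex_Theta ballI allI impI)
  fix \<theta> \<theta>' :: "('n, 'm, 'N) policy" and u v :: real
  assume \<theta>: "\<theta> \<in> Theta" "\<theta>' \<in> Theta" and uv: "0 \<le> u" "0 \<le> v" "u + v = 1"
  let ?V = "\<lambda>\<theta> \<omega>. V (xbar A B x0 \<theta> (W \<omega>), ubar \<theta> (W \<omega>))"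
  have "(\<integral>\<omega>. ?V (u *\<^sub>R \<theta> + v *\<^sub>R \<theta>') \<omega> \<partial>M) \<le> (\<integral>\<omega>. u * ?V \<theta> \<omega> + v * ?V \<theta>' \<omega> \<partial>M)"
  proof (rule integral_mono)
    show "integrable M (?V (u *\<^sub>R \<theta> + v *\<^sub>R \<theta>'))"
      using \<theta> uv by (intro int convexD[OF convex_Theta])
    show "integrable M (\<lambda>\<omega>. u * ?V \<theta> \<omega> + v * ?V \<theta>' \<omega>)"
      using \<theta> by (intro Bochner_Integration.integrable_add integrable_mult_right int)
    fix \<omega>
    show "?V (u *\<^sub>R \<theta> + v *\<^sub>R \<theta>') \<omega> \<le> u * ?V \<theta> \<omega> + v * ?V \<theta>' \<omega>"
      unfolding trajectory_convex_combination[OF uv(3)]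
      using V uv unfolding convex_on_def by blast
  qed
  also have "\<dots> = u * (\<integral>\<omega>. ?V \<theta> \<omega> \<partial>M) + v * (\<integral>\<omega>. ?V \<theta>' \<omega> \<partial>M)"
    using \<theta> by (subst Bochner_Integration.integral_add) (auto intro!: int)
  finally show "(\<integral>\<omega>. ?V (u *\<^sub>R \<theta> + v *\<^sub>R \<theta>') \<omega> \<partial>M)
      \<le> u * (\<integral>\<omega>. ?V \<theta> \<omega> \<partial>M) + v * (\<integral>\<omega>. ?V \<theta>' \<omega> \<partial>M)" .
qed

lemma linear_matrix_mult_row:
  fixes K :: "real ^ 'b ^ 'c"
  shows "linear (\<lambda>G :: real ^ 'd ^ 'b. (K ** G) $ i)"
  by (rule linearI)
     (simp_all add: vec_eq_iff matrix_matrix_mult_def sum.distrib distrib_left sum_distrib_left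
       mult.left_commute)

text \<open>
  The matrix \<open>P\<close> is affine in the gain and the vector \<open>h\<close> is affine in the offset of the policy. The
  sign of \<open>b\<close> is what permits \<open>b * norm v = norm (b *\<^sub>R v)\<close>.
\<close>

lemma soc_constraint_cone:
  fixes A :: "real ^ 'n ^ 'n" and S :: "real ^ ('N::{finite, linorder} \<times> 'n) ^ ('N \<times> 'n)"
    and Tx :: "real ^ ('N option \<times> 'n) ^ 'r" and Tu :: "real ^ ('N \<times> 'm::finite) ^ 'r"
  assumes b: "0 \<le> b"
  shows "soc_constraint TYPE(real ^ ('N \<times> 'n)) T
    (\<lambda>\<theta>. h_vec A B x0 Tx Tu y \<theta> $ i + b * norm (S *v (P_mat A B Tx Tu \<theta> $ i)) \<le> 0)"
proof -
  let ?K = "Tx ** Bbar A B + Tu"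
  let ?L = "\<lambda>\<theta> :: ('n, 'm, 'N) policy. b *\<^sub>R (S *v ((?K ** fst \<theta>) $ i))"
  let ?c = "b *\<^sub>R (S *v ((Tx ** Dbar A) $ i))"
  let ?l = "\<lambda>\<theta> :: ('n, 'm, 'N) policy. - ((?K *v snd \<theta>) $ i)"
  let ?d = "- (((Tx ** Abar A) *v x0 - y) $ i)"
  have "linear (\<lambda>\<theta> :: ('n, 'm, 'N) policy. (?K ** fst \<theta>) $ i)"
    using linear_compose[OF linear_fst linear_matrix_mult_row[of ?K i]] by (simp add: o_def)
  then have L: "linear ?L"
    by (intro linear_compose_scale_right)
       (use linear_compose[OF _ matrix_vector_mul_linear[of S]] in \<open>simp add: o_def\<close>)
  have l: "linear ?l"
    by (rule linearI) (simp_all add: matrix_vector_right_distrib matrix_vector_mult_scaleR)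
  have "h_vec A B x0 Tx Tu y \<theta> $ i + b * norm (S *v (P_mat A B Tx Tu \<theta> $ i)) \<le> 0
      \<longleftrightarrow> norm (?L \<theta> + ?c) \<le> ?l \<theta> + ?d" for \<theta>
  proof -
    have "?L \<theta> + ?c = b *\<^sub>R (S *v (P_mat A B Tx Tu \<theta> $ i))"
      by (simp add: P_mat_def matrix_vector_right_distrib scaleR_right_distrib add.commute)
    moreover have "?l \<theta> + ?d = - (h_vec A B x0 Tx Tu y \<theta> $ i)"
      by (simp add: h_vec_def)
    ultimately show ?thesis
      using b by auto
  qed
  with L l show ?thesis
    unfolding soc_constraint_def by blast
qed

theorem proposition6:
  fixes M :: "'w measure"
    and A :: "real ^ 'n ^ 'n" and B :: "real ^ 'm ^ 'n" and x0 :: "real ^ 'n"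
    and w :: "'N::{finite, linorder} \<Rightarrow> 'w \<Rightarrow> real ^ 'n"
    and \<Sigma> S :: "real ^ ('N \<times> 'n) ^ ('N \<times> 'n)"
    and Tx :: "real ^ ('N option \<times> 'n) ^ 'r" and Tu :: "real ^ ('N \<times> 'm) ^ 'r"
    and y :: "real ^ 'r" and \<alpha> :: "'r \<Rightarrow> real"
  assumes "prob_space M"
    and "\<And>t. w t \<in> borel_measurable M"
    and "positive_definite \<Sigma>"
    and "centered_gaussian M (stack w) \<Sigma>"
    and "transpose S = S" and "S ** S = \<Sigma>"
    and "\<And>i. 0 < \<alpha> i \<and> \<alpha> i < 1"
  shows
    "(\<forall>i. (\<forall>\<theta>\<in>Theta.
        \<P>(\<omega> in M. eta Tx Tu y (xbar A B x0 \<theta> (stack w \<omega>)) (ubar \<theta> (stack w \<omega>)) $ i \<le> 0) \<ge> 1 - \<alpha> i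
        \<longleftrightarrow> h_vec A B x0 Tx Tu y \<theta> $ i + beta (\<alpha> i) * norm (S *v (P_mat A B Tx Tu \<theta> $ i)) \<le> 0) \<and>
      (\<alpha> i \<le> 1 / 2 \<longrightarrow> soc_constraint TYPE(real ^ ('N \<times> 'n)) Theta
        (\<lambda>\<theta>. h_vec A B x0 Tx Tu y \<theta> $ i + beta (\<alpha> i) * norm (S *v (P_mat A B Tx Tu \<theta> $ i)) \<le> 0))) \<and>
     (\<forall>(V :: (real ^ ('N option \<times> 'n)) \<times> (real ^ ('N \<times> 'm)) \<Rightarrow> real) a.
        V \<in> borel_measurable borel \<and> convex_on UNIV V \<and>
        (\<forall>\<theta>\<in>Theta. integrable M (\<lambda>\<omega>. V (xbar A B x0 \<theta> (stack w \<omega>), ubar \<theta> (stack w \<omega>)))) \<and>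
        (\<Sum>i\<in>UNIV. \<alpha> i) = a \<and> 0 < a \<and> a < 1
        \<longrightarrow>
        (let J = (\<lambda>\<theta>. \<integral>\<omega>. V (xbar A B x0 \<theta> (stack w \<omega>), ubar \<theta> (stack w \<omega>)) \<partial>M);
             p = Problem Theta J (\<lambda>\<theta>. \<forall>i. h_vec A B x0 Tx Tu y \<theta> $ i
                   + beta (\<alpha> i) * norm (S *v (P_mat A B Tx Tu \<theta> $ i)) \<le> 0);
             q = Problem Theta J (\<lambda>\<theta>.
                   \<P>(\<omega> in M. eta Tx Tu y (xbar A B x0 \<theta> (stack w \<omega>)) (ubar \<theta> (stack w \<omega>)) \<le> 0)
                     \<ge> 1 - a)
         in conservative_approximation p q \<and> convex_on Theta J \<and>
            ((\<forall>i. \<alpha> i \<le> 1 / 2) \<longrightarrow> convex_conservative_approximation p q)))"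
proof -
  interpret prob_space M by fact
  note gauss = assms(4)[folded assms(6)] and pd = assms(3)[folded assms(6)]
  have W[measurable]: "stack w \<in> borel_measurable M"
    using assms(4) distributed_measurable unfolding centered_gaussian_def by fastforce
  let ?X = "\<lambda>\<theta> \<omega>. eta Tx Tu y (xbar A B x0 \<theta> (stack w \<omega>)) (ubar \<theta> (stack w \<omega>))"
  let ?cone = "\<lambda>\<theta> i. h_vec A B x0 Tx Tu y \<theta> $ i
    + beta (\<alpha> i) * norm (S *v (P_mat A B Tx Tu \<theta> $ i)) \<le> 0"
  have chance: "1 - \<alpha> i \<le> \<P>(\<omega> in M. ?X \<theta> \<omega> $ i \<le> 0) \<longleftrightarrow> ?cone \<theta> i" for \<theta> i
    unfolding eta_component_affine
    using chance_constraint_iff[OF assms(1) gauss pd assms(5)] assms(7)[of i] by blast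
  have soc: "soc_constraint TYPE(real ^ ('N \<times> 'n)) Theta (\<lambda>\<theta>. ?cone \<theta> i)" if "\<alpha> i \<le> 1 / 2" for i
    using assms(7)[of i] that by (intro soc_constraint_cone beta_nonneg) auto
  have X: "?X \<theta> \<in> borel_measurable M" for \<theta>
    unfolding eta_eq_affine
    by (intro borel_measurable_add borel_measurable_const measurable_compose[OF W]
        borel_measurable_continuous_onI linear_continuous_on)
       (simp add: matrix_vector_mul_bounded_linear)
  have joint: "1 - (\<Sum>i\<in>UNIV. \<alpha> i) \<le> \<P>(\<omega> in M. ?X \<theta> \<omega> \<le> 0)" if "\<forall>i. ?cone \<theta> i" for \<theta>
    using that chance by (intro union_bound_componentwise X) auto
  have feasible_convex: "convex {\<theta> \<in> Theta. \<forall>i. ?cone \<theta> i}" if "\<forall>i. \<alpha> i \<le> 1 / 2"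
  proof -
    have "{\<theta> \<in> Theta. \<forall>i. ?cone \<theta> i} = (\<Inter>i. {\<theta> \<in> Theta. ?cone \<theta> i})"
      by auto
    also have "convex \<dots>"
      using that by (intro convex_INT convex_soc_constraint[OF soc] convex_Theta) auto
    finally show ?thesis .
  qed
  show ?thesis
    unfolding Let_def conservative_approximation_def convex_conservative_approximation_def
      feasible_def problem.sel
    using chance soc joint feasible_convex convex_on_expected_cost[of _ M A B x0 "stack w"]
    by (intro conjI allI impI ballI) auto
qed

end
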